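(* Let $p$ be an odd prime, $q\in\mathbb{C}_p$ with $|1-q|_p<p^{-1/(p-1)}$, $\alpha\in\mathbb{N}$, and $n\in\mathbb{Z}_+$ with $n>1$. Then $$q^2\widetilde{\beta}_{n,q}^{(\alpha)}(2)=nq^{1+\alpha}\frac{\alpha}{[\alpha]_q}+q^2-q+\widetilde{\beta}_{n,q}^{(\alpha)}.$$
   Context: $q^x=\exp(x\log q)$ for $x\in\mathbb{Z}_p$; $[x]_q=\frac{1-q^x}{1-q}$, $[\alpha]_q=\frac{1-q^\alpha}{1-q}$, $[x]_{q^\alpha}=\frac{1-q^{\alpha x}}{1-q^\alpha}$. For uniformly differentiable $f:\mathbb{Z}_p\to\mathbb{C}_p$, $\int_{\mathbb{Z}_p}f(y)\,d\mu_q(y)=\lim_{N\to\infty}\frac{1}{[p^N]_q}\sum_{y=0}^{p^N-1}f(y)q^y$. Define $\widetilde{\beta}_{n,q}^{(\alpha)}(x)=\int_{\mathbb{Z}_p}[x+y]_{q^\alpha}^n\,d\mu_q(y)$ for $x\in\mathbb{Z}_p$, and $\widetilde{\beta}_{n,q}^{(\alpha)}=\widetilde{\beta}_{n,q}^{(\alpha)}(0)$. *)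

theory Defs
  imports "HOL-Analysis.Analysis" "HOL-Computational_Algebra.Computational_Algebra"
begin

text \<open>
  The field of p-adic complex numbers is not available in the library. It is described here up to
  isometric isomorphism: a type of sort \<open>{field_char_0, complete_space}\<close> whose metric comes from a
  non-archimedean absolute value normalised by |p| = 1/p, and which is the completion of
  an algebraic closure of the p-adic rationals.
\<close>

definition padic_abs :: "'a::{field_char_0, complete_space} \<Rightarrow> real" where
  "padic_abs x = dist x 0"

text \<open>
  The absolute value restricts to the p-adic one on the rational numbers, so the topological
  closure of the rational numbers in the (complete) ambient field is a copy of the p-adic numbers.
\<close>

definition padic_rats :: "'a::{field_char_0, complete_space} set" where
  "padic_rats = closure \<rat>"

definition padic_algebraic :: "'a::{field_char_0, complete_space} set" where
  "padic_algebraic =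
     {x. \<exists>P. P \<noteq> 0 \<and> (\<forall>i. coeff P i \<in> padic_rats) \<and> poly P x = 0}"

definition is_padic_complex :: "nat \<Rightarrow> 'a::{field_char_0, complete_space} itself \<Rightarrow> bool" where
  "is_padic_complex p (_ :: 'a itself) \<longleftrightarrow>
     prime p \<and>
     (\<forall>x y :: 'a. dist x y = padic_abs (x - y)) \<and>
     (\<forall>x y :: 'a. padic_abs (x * y) = padic_abs x * padic_abs y) \<and>
     (\<forall>x y :: 'a. padic_abs (x + y) \<le> max (padic_abs x) (padic_abs y)) \<and>
     padic_abs (of_nat p :: 'a) = 1 / real p \<and>
     (\<forall>P :: 'a poly. degree P > 0 \<and> (\<forall>i. coeff P i \<in> padic_algebraic) \<longrightarrow>
        (\<exists>x \<in> padic_algebraic. poly P x = 0)) \<and>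
     closure (padic_algebraic :: 'a set) = UNIV"

definition padic_exp :: "'a::{field_char_0, complete_space} \<Rightarrow> 'a" where
  "padic_exp x = (\<Sum>k. x ^ k / fact k)"

definition padic_log :: "'a::{field_char_0, complete_space} \<Rightarrow> 'a" where
  "padic_log x = (\<Sum>k. (- 1) ^ k * (x - 1) ^ Suc k / of_nat (Suc k))"

definition padic_pow :: "'a::{field_char_0, complete_space} \<Rightarrow> 'a \<Rightarrow> 'a" where
  "padic_pow q x = padic_exp (x * padic_log q)"

text \<open>
  The bracket with base \<open>q\<close>, and the one with base \<open>q ^ \<alpha>\<close>, where
  (1 - q^(alpha x)) / (1 - q^alpha) is used. At base 1, where these quotients are 0/0, the
  limit value \<open>x\<close> is taken instead of the value 0 that the division of the library would give.
\<close>

definition q_bracket :: "'a::{field_char_0, complete_space} \<Rightarrow> 'a \<Rightarrow> 'a" where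
  "q_bracket q x = (if q = 1 then x else (1 - padic_pow q x) / (1 - q))"

definition q_bracket_pow :: "'a::{field_char_0, complete_space} \<Rightarrow> nat \<Rightarrow> 'a \<Rightarrow> 'a" where
  "q_bracket_pow q \<alpha> x =
     (if q ^ \<alpha> = 1 then x else (1 - padic_pow q (of_nat \<alpha> * x)) / (1 - q ^ \<alpha>))"

text \<open>
  Only the values of \<open>f\<close> at natural numbers enter. The limit exists for uniformly differentiable
  \<open>f\<close>; otherwise \<open>lim\<close> yields an unspecified value.
\<close>

definition padic_q_integral ::
  "nat \<Rightarrow> 'a::{field_char_0, complete_space} \<Rightarrow> ('a \<Rightarrow> 'a) \<Rightarrow> 'a" where
  "padic_q_integral p q f =
     lim (\<lambda>N. 1 / q_bracket q (of_nat (p ^ N)) * (\<Sum>y<p ^ N. f (of_nat y) * q ^ y))"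

definition q_bernoulli_poly ::
  "nat \<Rightarrow> nat \<Rightarrow> nat \<Rightarrow> 'a::{field_char_0, complete_space} \<Rightarrow> 'a \<Rightarrow> 'a" where
  "q_bernoulli_poly p \<alpha> n q x = padic_q_integral p q (\<lambda>y. q_bracket_pow q \<alpha> (x + y) ^ n)"

definition q_bernoulli :: "nat \<Rightarrow> nat \<Rightarrow> nat \<Rightarrow> 'a::{field_char_0, complete_space} \<Rightarrow> 'a" where
  "q_bernoulli p \<alpha> n q = q_bernoulli_poly p \<alpha> n q 0"

end

theory Submission imports Defs begin

text \<open>
  Put [m] = 1 + q + ... + q^(m-1). For |q - 1| < p^(-1/(p-1)) the binomial expansion gives
  |[m]| = |m|. It also shows that (q^(p^N) - 1) / p^N tends to log q, whence r = exp (log q) / q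
  satisfies |r^(p^N) - 1| = o(p^(-N)); as the left-hand side is p^(-N) |r - 1|, it follows that r = 1.
  This identifies q^m = exp (m log q) with the ordinary power, so all brackets are geometric sums.

  The Riemann sums S(f) = (1 / [p^N]) * (\<Sum>y<p^N. f y * q^y) satisfy the telescoping relation
  q S(f(\<sqdot> + 1)) - S(f) = (f(p^N) q^(p^N) - f(0)) / [p^N]. Let f = u^k, where u is the bracket with
  base q^\<alpha>. The boundary term converges because u(p^N) / [p^N] tends to \<alpha> / [\<alpha>], and expanding the powers
  of u(y + 1) = 1 + q^\<alpha> u(y) turns the relation into a recursion for the moments,
  which proves that they converge; applying it twice to the n-th moment yields the theorem.
\<close>

section \<open>Basic rules for the non-archimedean absolute value\<close>

locale padic_field =
  fixes p :: nat and T :: "'a::{field_char_0, complete_space} itself"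
  assumes p_prime: "prime p"
    and dist_eq: "dist x y = padic_abs (x - y :: 'a)"
    and abs_mult: "padic_abs (x * y :: 'a) = padic_abs x * padic_abs y"
    and ultrametric: "padic_abs (x + y :: 'a) \<le> max (padic_abs x) (padic_abs y)"
    and abs_p: "padic_abs (of_nat p :: 'a) = 1 / real p"
begin

text \<open>The radius of convergence of the p-adic exponential series: each factor 1/p in the
  absolute value of a factorial is worth \<open>p - 1\<close> factors \<open>rho\<close>.\<close>

definition rho :: real where "rho = real p powr (- 1 / (real p - 1))"

lemma p_gt_1: "real p > 1"
  using prime_gt_1_nat[OF p_prime] by simp

lemma rho_pos: "0 < rho"
  using p_gt_1 by (simp add: rho_def)

lemma rho_less_1: "rho < 1"
  unfolding rho_def using p_gt_1 powr_less_mono[of "- 1 / (real p - 1)" 0 "real p"] by simp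

lemma rho_power: "rho ^ (p - 1) = 1 / real p"
proof -
  have "rho ^ (p - 1) = real p powr (- 1 / (real p - 1) * real (p - 1))"
    unfolding rho_def using p_gt_1 by (simp add: powr_powr flip: powr_realpow)
  also have "- 1 / (real p - 1) * real (p - 1) = - 1"
    using p_gt_1 by (simp add: of_nat_diff)
  finally show ?thesis using p_gt_1 by (simp add: powr_minus field_simps)
qed

lemma abs_nonneg [simp]: "0 \<le> padic_abs (x :: 'a)"
  by (simp add: padic_abs_def)

lemma abs_zero [simp]: "padic_abs (0 :: 'a) = 0"
  by (simp add: padic_abs_def)

lemma abs_eq_0 [simp]: "padic_abs (x :: 'a) = 0 \<longleftrightarrow> x = 0"
  by (simp add: padic_abs_def)

lemma abs_pos_iff [simp]: "0 < padic_abs (x :: 'a) \<longleftrightarrow> x \<noteq> 0"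
  by (simp add: less_le)

lemma abs_one [simp]: "padic_abs (1 :: 'a) = 1"
  using abs_mult[of 1 1] abs_eq_0[of 1] by simp

lemma abs_minus_commute: "padic_abs (x - y :: 'a) = padic_abs (y - x)"
  by (metis dist_eq dist_commute)

lemma abs_minus [simp]: "padic_abs (- x :: 'a) = padic_abs x"
  using abs_minus_commute[of 0 x] by simp

lemma ultrametric_diff: "padic_abs (x - y :: 'a) \<le> max (padic_abs x) (padic_abs y)"
  using ultrametric[of x "- y"] by simp

lemma abs_power: "padic_abs (x ^ n :: 'a) = padic_abs x ^ n"
  by (induction n) (auto simp: abs_mult)

lemma abs_inverse: "padic_abs (inverse x :: 'a) = inverse (padic_abs x)"
proof (cases "x = 0")
  case False
  then have "padic_abs x * padic_abs (inverse x) = 1"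
    by (simp flip: abs_mult)
  then show ?thesis by (metis inverse_unique)
qed auto

lemma abs_divide: "padic_abs (x / y :: 'a) = padic_abs x / padic_abs y"
  by (simp add: divide_inverse abs_mult abs_inverse)

lemma abs_sum_le:
  assumes "\<And>i. i \<in> A \<Longrightarrow> padic_abs (f i :: 'a) \<le> B" "0 \<le> B"
  shows "padic_abs (sum f A) \<le> B"
  using assms
proof (induction A rule: infinite_finite_induct)
  case (insert x F)
  have "padic_abs (f x + sum f F) \<le> max (padic_abs (f x)) (padic_abs (sum f F))"
    by (rule ultrametric)
  also have "\<dots> \<le> B"
    using insert by simp
  finally show ?case using insert.hyps by simp
qed auto

text \<open>Every triangle is isosceles: x = (x - y) + y gives |x| \<le> |y|, and in y = x - (x - y)
  the term x - y is too small to attain the maximum.\<close>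

lemma abs_eq_of_close:
  assumes "padic_abs (x - y :: 'a) < padic_abs y"
  shows "padic_abs x = padic_abs y"
  using ultrametric[of "x - y" y] ultrametric_diff[of x "x - y"] assms by auto

section \<open>Absolute values of natural numbers and factorials\<close>

lemma abs_of_nat_le_1: "padic_abs (of_nat k :: 'a) \<le> 1"
proof (induction k)
  case (Suc k)
  then show ?case using ultrametric[of 1 "of_nat k"] by simp
qed simp

text \<open>Bezout gives a * k = b * p + 1, which has absolute value 1 because |b * p| < 1. Neither
  factor on the left exceeds 1 in absolute value, so neither can be smaller.\<close>

lemma abs_of_nat_not_dvd:
  assumes "\<not> p dvd k"
  shows "padic_abs (of_nat k :: 'a) = 1"
proof -
  have "coprime k p"
    using prime_imp_coprime[OF p_prime assms] by (simp add: coprime_commute)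
  moreover have "k \<noteq> 0" using assms by (cases k) auto
  ultimately obtain a b where ab: "a * k = b * p + 1"
    using bezout_nat[of k p] by (auto simp: mult.commute)
  have "padic_abs (of_nat (b * p) :: 'a) < 1"
    using abs_of_nat_le_1[of b] p_gt_1
    by (simp add: abs_mult abs_p divide_simps)
  then have "padic_abs (of_nat (a * k) :: 'a) = padic_abs (1 :: 'a)"
    by (intro abs_eq_of_close) (simp add: ab)
  then have "padic_abs (of_nat a :: 'a) * padic_abs (of_nat k :: 'a) = 1"
    by (simp add: abs_mult)
  moreover have "padic_abs (of_nat a :: 'a) * padic_abs (of_nat k :: 'a) \<le> padic_abs (of_nat k :: 'a)"
    using abs_of_nat_le_1[of a] by (simp add: mult_left_le_one_le)
  ultimately show ?thesis using abs_of_nat_le_1[of k] by linarith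
qed

text \<open>One step of Legendre's formula. Only the multiples of p up to k contribute to |k!|;
  pulling one p out of each leaves the factorial of \<open>k div p\<close>.\<close>

lemma abs_fact_div:
  "padic_abs (fact k :: 'a) = (1 / real p) ^ (k div p) * padic_abs (fact (k div p) :: 'a)"
proof (induction k)
  case (Suc k)
  show ?case
  proof (cases "p dvd Suc k")
    case False
    then have "Suc k div p = k div p"
      by (metis div_Suc dvd_eq_mod_eq_0)
    moreover have "padic_abs (fact (Suc k) :: 'a) = padic_abs (fact k :: 'a)"
      using abs_of_nat_not_dvd[OF False] by (simp only: fact_Suc abs_mult)
    ultimately show ?thesis using Suc by simp
  next
    case True
    then have eq: "Suc k div p = Suc (k div p)"
      by (metis div_Suc dvd_eq_mod_eq_0)
    have "of_nat (Suc k) = (of_nat p * of_nat (Suc (k div p)) :: 'a)"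
      using True by (metis dvd_mult_div_cancel eq of_nat_mult)
    then have "padic_abs (fact (Suc k) :: 'a) =
        1 / real p * padic_abs (of_nat (Suc (k div p)) :: 'a) * padic_abs (fact k :: 'a)"
      by (simp only: fact_Suc abs_mult abs_p)
    also have "\<dots> = (1 / real p) ^ Suc (k div p) * padic_abs (fact (Suc (k div p)) :: 'a)"
      unfolding Suc by (simp only: fact_Suc abs_mult power_Suc mult_ac)
    finally show ?thesis unfolding eq .
  qed
qed simp

text \<open>Legendre's bound: the exponent of p in k! is at most (k - 1) / (p - 1). It follows by
  iterating \<open>abs_fact_div\<close>.\<close>

lemma rho_power_le_abs_fact: "k \<ge> 1 \<Longrightarrow> rho ^ (k - 1) \<le> padic_abs (fact k :: 'a)"
proof (induction k rule: less_induct)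
  case (less k)
  define m where "m = k div p"
  have p1: "p > 1" using p_gt_1 by simp
  show ?case
  proof (cases "m = 0")
    case True
    then have "padic_abs (fact k :: 'a) = 1" using abs_fact_div[of k] by (simp add: m_def)
    then show ?thesis using rho_pos rho_less_1 by (simp add: power_le_one)
  next
    case False
    have mk: "m < k" unfolding m_def using p1 less.prems by (intro div_less_dividend) auto
    have pm: "p * m \<le> k" by (simp add: m_def)
    \<comment> \<open>The m factors 1/p cost (p - 1) * m powers of \<open>rho\<close>, the induction
      hypothesis m - 1 more; the total stays at most k - 1.\<close>
    have e: "(p - 1) * m + (m - 1) = p * m - 1"
      using False p1 by (cases p; cases m) (auto simp: algebra_simps)
    have "rho ^ (k - 1) \<le> rho ^ ((p - 1) * m + (m - 1))"
      unfolding e using rho_pos rho_less_1 pm by (intro power_decreasing) auto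
    also have "\<dots> = (1 / real p) ^ m * rho ^ (m - 1)"
      unfolding power_add power_mult rho_power ..
    also have "\<dots> \<le> (1 / real p) ^ m * padic_abs (fact m :: 'a)"
      using less.IH[OF mk] False by (intro mult_left_mono) auto
    finally show ?thesis using abs_fact_div[of k] by (simp add: m_def)
  qed
qed

text \<open>In (Suc k)! the cofactor k! of \<open>Suc k\<close> has absolute value at most 1. Hence
  the logarithm is controlled by the same geometric series as the exponential.\<close>

lemma rho_power_le_abs_of_nat: "rho ^ k \<le> padic_abs (of_nat (Suc k) :: 'a)"
proof -
  have "rho ^ k \<le> padic_abs (fact (Suc k) :: 'a)"
    using rho_power_le_abs_fact[of "Suc k"] by simp
  also have "\<dots> = padic_abs (of_nat (Suc k) :: 'a) * padic_abs (of_nat (fact k) :: 'a)"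
    by (simp only: fact_Suc abs_mult of_nat_fact)
  also have "\<dots> \<le> padic_abs (of_nat (Suc k) :: 'a)"
    using abs_of_nat_le_1[of "fact k"] by (simp add: mult_left_le)
  finally show ?thesis .
qed

lemma abs_of_nat_ge: "k \<ge> 1 \<Longrightarrow> 1 / real k \<le> padic_abs (of_nat k :: 'a)"
proof (induction k rule: less_induct)
  case (less k)
  show ?case
  proof (cases "p dvd k")
    case False
    then show ?thesis using less.prems abs_of_nat_not_dvd[of k] by (simp add: divide_simps)
  next
    case True
    then obtain m where k: "k = p * m" by blast
    have m: "m \<ge> 1" using less.prems by (cases m) (auto simp: k)
    moreover have "p > 1" using p_gt_1 by simp
    ultimately have "m < k" by (simp add: k)
    have "1 / real k = 1 / real p * (1 / real m)" by (simp add: k)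
    also have "\<dots> \<le> 1 / real p * padic_abs (of_nat m :: 'a)"
      using less.IH[OF \<open>m < k\<close> m] by (intro mult_left_mono) auto
    finally show ?thesis by (simp add: k abs_mult abs_p)
  qed
qed

lemma abs_p_power: "padic_abs (of_nat (p ^ N) :: 'a) = (1 / real p) ^ N"
  by (simp add: abs_power abs_p)

lemma p_power_null: "(\<lambda>N. (1 / real p) ^ N) \<longlonglongrightarrow> 0"
  using p_gt_1 by (intro LIMSEQ_realpow_zero) auto

subsection \<open>Limits and series\<close>

lemma tendsto_iff_abs: "X \<longlonglongrightarrow> (l :: 'a) \<longleftrightarrow> (\<lambda>n. padic_abs (X n - l)) \<longlonglongrightarrow> 0"
  by (subst tendsto_dist_iff) (simp add: dist_eq)

lemma tendsto_absI:
  assumes "\<And>n. padic_abs (X n - l :: 'a) \<le> g n" "g \<longlonglongrightarrow> 0"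
  shows "X \<longlonglongrightarrow> l"
  unfolding tendsto_iff_abs
  by (rule tendsto_sandwich[OF _ _ tendsto_const assms(2)]) (auto simp: assms(1))

lemma tendsto_add_padic:
  assumes "X \<longlonglongrightarrow> (a :: 'a)" "Y \<longlonglongrightarrow> b"
  shows "(\<lambda>n. X n + Y n) \<longlonglongrightarrow> a + b"
proof (rule tendsto_absI)
  show "padic_abs (X n + Y n - (a + b)) \<le> max (padic_abs (X n - a)) (padic_abs (Y n - b))" for n
    using ultrametric[of "X n - a" "Y n - b"] by (simp add: algebra_simps)
  show "(\<lambda>n. max (padic_abs (X n - a)) (padic_abs (Y n - b))) \<longlonglongrightarrow> 0"
    using tendsto_max[OF assms[unfolded tendsto_iff_abs]] by simp
qed

lemma tendsto_mult_left_padic: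
  assumes "X \<longlonglongrightarrow> (a :: 'a)"
  shows "(\<lambda>n. c * X n) \<longlonglongrightarrow> c * a"
  unfolding tendsto_iff_abs using tendsto_mult_right_zero[OF assms[unfolded tendsto_iff_abs], of "padic_abs c"]
  by (simp add: abs_mult flip: right_diff_distrib)

lemma tendsto_minus_padic: "X \<longlonglongrightarrow> (a :: 'a) \<Longrightarrow> (\<lambda>n. - X n) \<longlonglongrightarrow> - a"
  using tendsto_mult_left_padic[of X a "-1"] by simp

lemma tendsto_diff_padic:
  "X \<longlonglongrightarrow> (a :: 'a) \<Longrightarrow> Y \<longlonglongrightarrow> b \<Longrightarrow> (\<lambda>n. X n - Y n) \<longlonglongrightarrow> a - b"
  using tendsto_add_padic[of X a "\<lambda>n. - Y n" "- b"] by (simp add: tendsto_minus_padic)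

text \<open>X * Y is (X - a) * (Y - b), a product of null sequences, plus terms linear in X or Y and
  a constant.\<close>

lemma tendsto_mult_padic:
  assumes X: "X \<longlonglongrightarrow> (a :: 'a)" and Y: "Y \<longlonglongrightarrow> b"
  shows "(\<lambda>n. X n * Y n) \<longlonglongrightarrow> a * b"
proof -
  have "(\<lambda>n. (X n - a) * (Y n - b)) \<longlonglongrightarrow> 0"
    unfolding tendsto_iff_abs
    using tendsto_mult_zero[OF X[unfolded tendsto_iff_abs] Y[unfolded tendsto_iff_abs]]
    by (simp add: abs_mult)
  then have "(\<lambda>n. (X n - a) * (Y n - b) + (a * Y n + b * X n) - a * b) \<longlonglongrightarrow> 0 + (a * b + b * a) - a * b"
    by (intro tendsto_add_padic tendsto_diff_padic tendsto_mult_left_padic X Y tendsto_const)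
  then show ?thesis by (simp add: algebra_simps)
qed

lemma tendsto_power_padic: "X \<longlonglongrightarrow> (a :: 'a) \<Longrightarrow> (\<lambda>n. X n ^ k) \<longlonglongrightarrow> a ^ k"
  by (induction k) (auto intro: tendsto_mult_padic)

lemma tendsto_sum_padic:
  "(\<And>i. i \<in> A \<Longrightarrow> (\<lambda>n. X i n) \<longlonglongrightarrow> (a i :: 'a)) \<Longrightarrow> (\<lambda>n. \<Sum>i\<in>A. X i n) \<longlonglongrightarrow> (\<Sum>i\<in>A. a i)"
  by (induction A rule: infinite_finite_induct) (auto intro: tendsto_add_padic)

lemma abs_limit_le:
  assumes "X \<longlonglongrightarrow> (l :: 'a)" "eventually (\<lambda>n. padic_abs (X n) \<le> B) sequentially"
  shows "padic_abs l \<le> B"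
proof (rule tendsto_upperbound)
  show "(\<lambda>n. padic_abs (X n)) \<longlonglongrightarrow> padic_abs l"
    unfolding padic_abs_def by (intro tendsto_intros assms)
qed (use assms in auto)

text \<open>In a complete ultrametric field null terms suffice: a block of terms is no larger than
  its largest member, so the partial sums are Cauchy.\<close>

lemma summable_padic:
  assumes "(\<lambda>k. padic_abs (a k :: 'a)) \<longlonglongrightarrow> 0"
  shows "summable a"
proof -
  have "Cauchy (\<lambda>n. \<Sum>k<n. a k)"
  proof (rule metric_CauchyI)
    fix e :: real assume "0 < e"
    then obtain M where M: "\<And>k. k \<ge> M \<Longrightarrow> padic_abs (a k) < e / 2"
      using LIMSEQ_D[OF assms, of "e/2"] by auto
    have close: "padic_abs ((\<Sum>k<n. a k) - (\<Sum>k<M. a k)) \<le> e / 2" if "n \<ge> M" for n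
    proof -
      have "(\<Sum>k<n. a k) - (\<Sum>k<M. a k) = (\<Sum>k\<in>{M..<n}. a k)"
        using that by (simp add: lessThan_atLeast0 sum_diff_nat_ivl)
      moreover have "padic_abs (\<Sum>k\<in>{M..<n}. a k) \<le> e / 2"
        using less_imp_le[OF M] \<open>0 < e\<close> by (intro abs_sum_le) auto
      ultimately show ?thesis by simp
    qed
    have "dist (\<Sum>k<m. a k) (\<Sum>k<n. a k) < e" if "m \<ge> M" "n \<ge> M" for m n
    proof -
      have "padic_abs ((\<Sum>k<m. a k) - (\<Sum>k<n. a k)) \<le> e / 2"
        using ultrametric_diff[of "(\<Sum>k<m. a k) - (\<Sum>k<M. a k)" "(\<Sum>k<n. a k) - (\<Sum>k<M. a k)"]
          close[OF that(1)] close[OF that(2)] by simp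
      with \<open>0 < e\<close> show ?thesis by (simp add: dist_eq)
    qed
    then show "\<exists>M. \<forall>m\<ge>M. \<forall>n\<ge>M. dist (\<Sum>k<m. a k) (\<Sum>k<n. a k) < e" by blast
  qed
  then show ?thesis
    by (metis Cauchy_convergent convergent_def sums_def summable_def)
qed

text \<open>Blocks of terms obey the bound of their members, and the bound survives the limit. The
  cases m = 0, 1, 2 estimate a series after its leading terms are split off.\<close>

lemma abs_suminf_tail_le:
  assumes "summable (a :: nat \<Rightarrow> 'a)" "\<And>k. k \<ge> m \<Longrightarrow> padic_abs (a k) \<le> B" "0 \<le> B"
  shows "padic_abs (suminf a - (\<Sum>k<m. a k)) \<le> B"
proof (rule abs_limit_le)
  have "(\<lambda>n. \<Sum>k<n. a k) \<longlonglongrightarrow> suminf a"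
    using assms(1) by (simp add: summable_LIMSEQ)
  then show "(\<lambda>n. (\<Sum>k<n. a k) - (\<Sum>k<m. a k)) \<longlonglongrightarrow> suminf a - (\<Sum>k<m. a k)"
    by (intro tendsto_diff_padic tendsto_const)
  have "padic_abs ((\<Sum>k<n. a k) - (\<Sum>k<m. a k)) \<le> B" if "n \<ge> m" for n
  proof -
    have "(\<Sum>k<n. a k) - (\<Sum>k<m. a k) = (\<Sum>k\<in>{m..<n}. a k)"
      using that by (simp add: lessThan_atLeast0 sum_diff_nat_ivl)
    then show ?thesis using assms by (auto intro!: abs_sum_le)
  qed
  then show "eventually (\<lambda>n. padic_abs ((\<Sum>k<n. a k) - (\<Sum>k<m. a k)) \<le> B) sequentially"
    using eventually_sequentially by blast
qed

subsection \<open>Exponential and logarithm\<close>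

text \<open>Legendre's bound has exponent one less than the power of x, so one factor |x| remains
  without a \<open>rho\<close> below it.\<close>

lemma abs_exp_term_Suc_le:
  "padic_abs (x ^ Suc k / fact (Suc k) :: 'a) \<le> padic_abs x * (padic_abs x / rho) ^ k"
proof -
  have "padic_abs (x ^ Suc k / fact (Suc k)) = padic_abs x ^ Suc k / padic_abs (fact (Suc k) :: 'a)"
    by (simp only: abs_divide abs_power)
  also have "\<dots> \<le> padic_abs x ^ Suc k / rho ^ k"
    using rho_power_le_abs_fact[of "Suc k"] rho_pos
    by (intro divide_left_mono mult_pos_pos) (simp_all del: fact_Suc)
  finally show ?thesis by (simp add: power_divide)
qed

lemma abs_exp_term_le: "padic_abs (x ^ k / fact k :: 'a) \<le> (padic_abs x / rho) ^ k"
proof (cases k)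
  case (Suc j)
  have "padic_abs x * (padic_abs x / rho) ^ j \<le> padic_abs x / rho * (padic_abs x / rho) ^ j"
    using rho_pos rho_less_1 by (intro mult_right_mono) (auto simp: divide_simps mult_left_le)
  then show ?thesis using abs_exp_term_Suc_le[of x j] by (simp add: Suc)
qed simp

lemma ratio_power_null:
  assumes "padic_abs (x :: 'a) < rho"
  shows "(\<lambda>k. (padic_abs x / rho) ^ k) \<longlonglongrightarrow> 0"
  using assms rho_pos by (intro LIMSEQ_realpow_zero) auto

lemma exp_summable:
  assumes "padic_abs (x :: 'a) < rho"
  shows "summable (\<lambda>k. x ^ k / fact k)"
proof (rule summable_padic)
  show "(\<lambda>k. padic_abs (x ^ k / fact k)) \<longlonglongrightarrow> 0"
    by (rule tendsto_sandwich[OF _ _ tendsto_const ratio_power_null[OF assms]])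
       (simp_all add: abs_exp_term_le)
qed

lemma abs_exp_minus_1_le:
  assumes "padic_abs (x :: 'a) < rho"
  shows "padic_abs (padic_exp x - 1) \<le> padic_abs x"
proof -
  have "padic_abs (x ^ k / fact k) \<le> padic_abs x" if "k \<ge> 1" for k
  proof -
    obtain j where k: "k = Suc j" using \<open>k \<ge> 1\<close> by (cases k) auto
    have "padic_abs x * (padic_abs x / rho) ^ j \<le> padic_abs x"
      using assms rho_pos by (intro mult_left_le power_le_one) auto
    then show ?thesis using abs_exp_term_Suc_le[of x j] unfolding k by linarith
  qed
  from abs_suminf_tail_le[OF exp_summable[OF assms] this, of 1] show ?thesis
    by (simp add: padic_exp_def)
qed

text \<open>Terms of degree at least 2 carry a further factor |x| / \<open>rho\<close>. For x = p^N
  * log q the error is of order p^(-2N), so it stays null after division by |p^N|.\<close>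

lemma abs_exp_minus_linear_le:
  assumes "padic_abs (x :: 'a) < rho"
  shows "padic_abs (padic_exp x - 1 - x) \<le> padic_abs x * (padic_abs x / rho)"
proof -
  have "padic_abs (x ^ k / fact k) \<le> padic_abs x * (padic_abs x / rho)" if "k \<ge> 2" for k
  proof -
    obtain j where k: "k = Suc j" "j \<ge> 1" using \<open>k \<ge> 2\<close> by (cases k) auto
    have "(padic_abs x / rho) ^ j \<le> (padic_abs x / rho) ^ 1"
      using assms rho_pos k by (intro power_decreasing) auto
    then have "padic_abs x * (padic_abs x / rho) ^ j \<le> padic_abs x * (padic_abs x / rho)"
      by (intro mult_left_mono) auto
    then show ?thesis using abs_exp_term_Suc_le[of x j] unfolding k by linarith
  qed
  from abs_suminf_tail_le[OF exp_summable[OF assms] this, of 2] rho_pos show ?thesis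
    by (simp add: padic_exp_def numeral_2_eq_2 diff_diff_eq)
qed

text \<open>The product of the n-th partial sums runs over a square, the partial sum for x + y over
  the triangle i + j < n. The remaining terms have i + j \<ge> n, hence absolute value at most c^n
  with c < 1.\<close>

lemma exp_add:
  assumes x: "padic_abs (x :: 'a) < rho" and y: "padic_abs y < rho"
  shows "padic_exp (x + y) = padic_exp x * padic_exp y"
proof -
  define a where "a z i = z ^ i / fact i" for z :: 'a and i
  define S where "S z n = (\<Sum>k<n. a z k)" for z n
  define c where "c = max (padic_abs x) (padic_abs y) / rho"
  have c: "0 \<le> c" "c < 1" using x y rho_pos by (auto simp: c_def le_max_iff_disj)
  have xy: "padic_abs (x + y) < rho" using ultrametric[of x y] x y by simp
  have S: "S z \<longlonglongrightarrow> padic_exp z" if "padic_abs z < rho" for z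
    using summable_LIMSEQ[OF exp_summable[OF that]] by (simp add: S_def[abs_def] a_def padic_exp_def)
  have a: "padic_abs (a z i) \<le> c ^ i" if "z = x \<or> z = y" for z i
  proof -
    have "(padic_abs z / rho) ^ i \<le> c ^ i"
      using that rho_pos unfolding c_def by (intro power_mono divide_right_mono) auto
    then show ?thesis using abs_exp_term_le[of z i] by (simp add: a_def)
  qed
  have bin: "a (x + y) k = (\<Sum>i\<le>k. a x i * a y (k - i))" for k
    by (simp add: a_def binomial_ring sum_divide_distrib binomial_fact field_simps)
  have diff: "padic_abs (S x n * S y n - S (x + y) n) \<le> c ^ n" for n
  proof -
    let ?D = "{(i, j). i + j < n}" and ?Q = "{..<n} \<times> {..<n}"
    have D: "?D \<subseteq> ?Q" by auto
    have "S x n * S y n = (\<Sum>(i, j)\<in>?Q. a x i * a y j)"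
      by (simp add: S_def sum_product sum.cartesian_product)
    moreover have "S (x + y) n = (\<Sum>(i, j)\<in>?D. a x i * a y j)"
      by (simp add: S_def bin sum.triangle_reindex)
    ultimately have "S x n * S y n - S (x + y) n = (\<Sum>(i, j)\<in>?Q - ?D. a x i * a y j)"
      using sum_diff[OF _ D, of "\<lambda>(i, j). a x i * a y j"] by simp
    moreover have "padic_abs (\<Sum>(i, j)\<in>?Q - ?D. a x i * a y j) \<le> c ^ n"
    proof (rule abs_sum_le)
      fix ij assume "ij \<in> ?Q - ?D"
      then obtain i j where ij: "ij = (i, j)" "i + j \<ge> n" by (cases ij) auto
      have "padic_abs (a x i * a y j) \<le> c ^ i * c ^ j"
        unfolding abs_mult using c a by (intro mult_mono) auto
      also have "\<dots> \<le> c ^ n"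
        unfolding power_add[symmetric] using c ij by (intro power_decreasing) auto
      finally show "padic_abs (case ij of (i, j) \<Rightarrow> a x i * a y j) \<le> c ^ n" by (simp add: ij)
    qed (use c in auto)
    ultimately show ?thesis by simp
  qed
  have "(\<lambda>n. S x n * S y n - S (x + y) n) \<longlonglongrightarrow> 0"
    using diff c by (intro tendsto_absI[where g = "\<lambda>n. c ^ n"] LIMSEQ_realpow_zero) auto
  moreover have "(\<lambda>n. S x n * S y n - S (x + y) n)
      \<longlonglongrightarrow> padic_exp x * padic_exp y - padic_exp (x + y)"
    by (intro tendsto_diff_padic tendsto_mult_padic S x y xy)
  ultimately show ?thesis using LIMSEQ_unique by force
qed

lemma abs_of_nat_mult_le: "padic_abs (of_nat m * x :: 'a) \<le> padic_abs x"
  using abs_of_nat_le_1[of m] by (simp add: abs_mult mult_left_le_one_le)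

lemma exp_of_nat_mult:
  assumes "padic_abs (x :: 'a) < rho"
  shows "padic_exp (of_nat m * x) = padic_exp x ^ m"
proof (induction m)
  case 0
  \<comment> \<open>The bound |exp x - 1| \<le> |x| at x = 0 forces exp 0 = 1.\<close>
  have "padic_abs (padic_exp 0 - 1 :: 'a) = 0"
    using abs_exp_minus_1_le[of 0] rho_pos by (intro antisym) auto
  then show ?case by simp
next
  case (Suc m)
  have "padic_abs (of_nat m * x) < rho"
    using abs_of_nat_mult_le[of m x] assms by linarith
  then show ?case using exp_add[of x "of_nat m * x"] assms Suc by (simp add: distrib_right)
qed

section \<open>Binomial expansion of geometric sums\<close>

lemma abs_eq_1:
  assumes "padic_abs (x - 1 :: 'a) < rho"
  shows "padic_abs x = 1"
  using abs_eq_of_close[of x 1] assms rho_less_1 by simp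

lemma of_nat_binomial_Suc:
  "(of_nat (m choose Suc k) :: 'a) = of_nat m * of_nat ((m - 1) choose k) / of_nat (Suc k)"
proof -
  have "(of_nat (Suc k) * of_nat (m choose Suc k) :: 'a) = of_nat m * of_nat ((m - 1) choose k)"
    using binomial_absorption[of k m] by (metis of_nat_mult)
  then show ?thesis by (simp add: field_simps del: of_nat_Suc)
qed

text \<open>This is ((1 + t)^m - 1) / t for t = q - 1, proved by Pascal's rule instead of division,
  so that q = 1 is included.\<close>

lemma geometric_sum_binomial:
  "(\<Sum>i<m. (q :: 'a) ^ i) = (\<Sum>k<m. of_nat (m choose Suc k) * (q - 1) ^ k)"
proof (induction m)
  case (Suc m)
  have "q ^ m = (\<Sum>k\<le>m. of_nat (m choose k) * (q - 1) ^ k)"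
    using binomial_ring[of "q - 1" 1 m] by simp
  then have "q ^ m = (\<Sum>k<Suc m. of_nat (m choose k) * (q - 1) ^ k)"
    by (simp only: lessThan_Suc_atMost)
  moreover have "(\<Sum>i<m. q ^ i) = (\<Sum>k<Suc m. of_nat (m choose Suc k) * (q - 1) ^ k)"
    using Suc by simp
  ultimately have "(\<Sum>i<Suc m. q ^ i) = (\<Sum>k<Suc m. of_nat (m choose Suc k) * (q - 1) ^ k)
      + (\<Sum>k<Suc m. of_nat (m choose k) * (q - 1) ^ k)"
    by simp
  also have "\<dots> = (\<Sum>k<Suc m. of_nat (Suc m choose Suc k) * (q - 1) ^ k)"
    unfolding sum.distrib[symmetric] by (intro sum.cong) (auto simp: algebra_simps)
  finally show ?case .
qed simp

lemma abs_power_div_le: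
  "padic_abs (t ^ k / of_nat (Suc k) :: 'a) \<le> (padic_abs t / rho) ^ k"
proof -
  have "padic_abs t ^ k / padic_abs (of_nat (Suc k) :: 'a) \<le> padic_abs t ^ k / rho ^ k"
    using rho_power_le_abs_of_nat[of k] rho_pos
    by (intro divide_left_mono mult_pos_pos) (simp_all del: of_nat_Suc)
  then show ?thesis by (simp only: abs_divide abs_power power_divide)
qed

text \<open>The term k = 0 of the expansion is m itself. By absorption every other term is m times
  something of absolute value at most c < 1, so m dominates.\<close>

lemma abs_geometric_sum:
  assumes "padic_abs (q - 1 :: 'a) < rho"
  shows "padic_abs (\<Sum>i<m. q ^ i) = padic_abs (of_nat m :: 'a)"
proof (cases "m = 0")
  case False
  define c where "c = padic_abs (q - 1) / rho"
  have c: "0 \<le> c" "c < 1" using assms rho_pos by (auto simp: c_def)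
  let ?f = "\<lambda>k. of_nat (m choose Suc k) * (q - 1) ^ k"
  have "(\<Sum>i<m. q ^ i) = ?f 0 + sum ?f {1..<m}"
    unfolding geometric_sum_binomial using False
    by (simp add: lessThan_atLeast0 sum.atLeast_Suc_lessThan)
  then have "(\<Sum>i<m. q ^ i) - of_nat m = sum ?f {1..<m}" by simp
  also have "padic_abs \<dots> \<le> padic_abs (of_nat m :: 'a) * c"
  proof (rule abs_sum_le)
    fix k assume k: "k \<in> {1..<m}"
    have "?f k = of_nat m * (of_nat ((m - 1) choose k) * ((q - 1) ^ k / of_nat (Suc k)))"
      by (simp add: of_nat_binomial_Suc del: of_nat_Suc)
    also have "padic_abs \<dots> \<le> padic_abs (of_nat m :: 'a) * padic_abs ((q - 1) ^ k / of_nat (Suc k))"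
      unfolding abs_mult[of "of_nat m"] by (intro mult_left_mono abs_of_nat_mult_le) auto
    also have "\<dots> \<le> padic_abs (of_nat m :: 'a) * c ^ k"
      unfolding c_def by (intro mult_left_mono abs_power_div_le) auto
    also have "\<dots> \<le> padic_abs (of_nat m :: 'a) * c ^ 1"
      using k c by (intro mult_left_mono power_decreasing) auto
    finally show "padic_abs (?f k) \<le> padic_abs (of_nat m :: 'a) * c" by simp
  qed (use c in auto)
  also have "\<dots> < padic_abs (of_nat m :: 'a)"
  proof -
    have "0 < padic_abs (of_nat m :: 'a)" using False by simp
    then show ?thesis using c by simp
  qed
  finally show ?thesis by (rule abs_eq_of_close)
qed simp

lemma abs_power_minus_1:
  assumes "padic_abs (q - 1 :: 'a) < rho"
  shows "padic_abs (q ^ m - 1) = padic_abs (q - 1) * padic_abs (of_nat m :: 'a)"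
  by (simp add: power_diff_1_eq abs_mult abs_geometric_sum assms)

section \<open>The logarithm as a limit, and exp (log q) = q\<close>

lemma abs_log_term_le:
  "padic_abs ((- 1) ^ k * (q - 1) ^ Suc k / of_nat (Suc k) :: 'a)
     \<le> padic_abs (q - 1) * (padic_abs (q - 1) / rho) ^ k"
proof -
  have "(- 1) ^ k * (q - 1) ^ Suc k / of_nat (Suc k) =
      (- 1) ^ k * (q - 1) * ((q - 1) ^ k / of_nat (Suc k))"
    by (simp del: of_nat_Suc)
  also have "padic_abs \<dots> = padic_abs (q - 1) * padic_abs ((q - 1) ^ k / of_nat (Suc k))"
    by (simp only: abs_mult abs_power abs_minus abs_one power_one mult_1)
  also have "\<dots> \<le> padic_abs (q - 1) * (padic_abs (q - 1) / rho) ^ k"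
    by (intro mult_left_mono abs_power_div_le) auto
  finally show ?thesis .
qed

lemma log_summable:
  assumes "padic_abs (q - 1 :: 'a) < rho"
  shows "summable (\<lambda>k. (- 1) ^ k * (q - 1) ^ Suc k / of_nat (Suc k))"
proof (rule summable_padic)
  show "(\<lambda>k. padic_abs ((- 1) ^ k * (q - 1) ^ Suc k / of_nat (Suc k))) \<longlonglongrightarrow> 0"
    by (rule tendsto_sandwich[OF _ _ tendsto_const
          tendsto_mult_right_zero[OF ratio_power_null[OF assms], of "padic_abs (q - 1)"]])
       (simp_all only: abs_log_term_le abs_nonneg eventually_True)
qed

lemma abs_log_le:
  assumes "padic_abs (q - 1 :: 'a) < rho"
  shows "padic_abs (padic_log q) \<le> padic_abs (q - 1)"
proof -
  have "padic_abs ((- 1) ^ k * (q - 1) ^ Suc k / of_nat (Suc k)) \<le> padic_abs (q - 1)" for k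
  proof -
    have "padic_abs (q - 1) * (padic_abs (q - 1) / rho) ^ k \<le> padic_abs (q - 1)"
      using assms rho_pos by (intro mult_left_le power_le_one) auto
    then show ?thesis using abs_log_term_le[of k q] by linarith
  qed
  from abs_suminf_tail_le[OF log_summable[OF assms] this, of 0] show ?thesis
    by (simp add: padic_log_def)
qed

text \<open>By Pascal's rule consecutive coefficients of m - 1 add up to (m choose k + 1), which
  absorption bounds by |m| * (k + 1). So they alternate up to small errors, of which the ultrametric
  inequality takes the maximum, not the sum.\<close>

lemma abs_binomial_minus_sign_le:
  "m \<ge> 1 \<Longrightarrow> padic_abs (of_nat ((m - 1) choose k) - (- 1) ^ k :: 'a)
     \<le> padic_abs (of_nat m :: 'a) * real k"
proof (induction k)
  case (Suc k)
  let ?b = "\<lambda>k. of_nat ((m - 1) choose k) :: 'a"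
  have m: "m = Suc (m - 1)" using Suc.prems by simp
  have "m choose Suc k = ((m - 1) choose k) + ((m - 1) choose Suc k)"
    by (subst m) (rule binomial_Suc_Suc)
  then have "(of_nat (m choose Suc k) :: 'a) = ?b k + ?b (Suc k)"
    by (simp only: of_nat_add)
  then have "?b (Suc k) - (- 1) ^ Suc k = of_nat (m choose Suc k) - (?b k - (- 1) ^ k)"
    by simp
  moreover have "padic_abs (of_nat (m choose Suc k) :: 'a) \<le> padic_abs (of_nat m :: 'a) * real (Suc k)"
  proof -
    have "of_nat (m choose Suc k) = ?b k * (of_nat m / of_nat (Suc k))"
      by (simp add: of_nat_binomial_Suc)
    also have "padic_abs \<dots> \<le> padic_abs (of_nat m / of_nat (Suc k) :: 'a)"
      by (rule abs_of_nat_mult_le)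
    also have "\<dots> = padic_abs (of_nat m :: 'a) / padic_abs (of_nat (Suc k) :: 'a)"
      by (rule abs_divide)
    also have "\<dots> \<le> padic_abs (of_nat m :: 'a) / (1 / real (Suc k))"
      using abs_of_nat_ge[of "Suc k"]
      by (intro divide_left_mono mult_pos_pos) (simp_all del: of_nat_Suc)
    finally show ?thesis by simp
  qed
  moreover have "padic_abs (?b k - (- 1) ^ k) \<le> padic_abs (of_nat m :: 'a) * real (Suc k)"
    using Suc.IH[OF Suc.prems] by (rule order_trans) (simp add: mult_left_mono)
  ultimately show ?case
    using ultrametric_diff[of "of_nat (m choose Suc k)" "?b k - (- 1) ^ k"]
    by (simp only: le_max_iff_disj) linarith
qed simp

text \<open>The quotient (q^m - 1) / m is the m-th partial sum of the logarithm with (-1)^k replaced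
  by (m - 1 choose k). The discrepancy is at most a constant times |m|, which is null along m =
  p^N.\<close>

lemma log_limit:
  assumes q: "padic_abs (q - 1 :: 'a) < rho"
  shows "(\<lambda>N. (q ^ (p ^ N) - 1) / of_nat (p ^ N)) \<longlonglongrightarrow> padic_log q"
proof -
  define t where "t = q - 1"
  define c where "c = padic_abs t / rho"
  have c: "0 \<le> c" "c < 1" using q rho_pos by (auto simp: c_def t_def)
  let ?a = "\<lambda>k. (- 1) ^ k * t ^ Suc k / of_nat (Suc k)"
  \<comment> \<open>Geometric decay beats the linear factor k of
    \<open>abs_binomial_minus_sign_le\<close>; this provides the constant K.\<close>
  have "(\<lambda>k. real k * c ^ k) \<longlonglongrightarrow> 0"
    using c by (intro powser_times_n_limit_0) auto
  then have "Bseq (\<lambda>k. real k * c ^ k)" by (intro convergent_imp_Bseq convergentI)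
  then obtain K where K: "\<And>k. real k * c ^ k \<le> K"
    unfolding Bseq_def by (metis abs_le_D1 real_norm_def)
  have K0: "0 \<le> K" using K[of 0] by simp
  have main: "padic_abs ((q ^ m - 1) / of_nat m - (\<Sum>k<m. ?a k))
      \<le> padic_abs (of_nat m :: 'a) * (padic_abs t * K)" if m: "m \<ge> 1" for m
  proof -
    have "(q ^ m - 1) / of_nat m = (\<Sum>k<m. of_nat ((m - 1) choose k) * t ^ Suc k / of_nat (Suc k))"
      using m unfolding power_diff_1_eq geometric_sum_binomial
      by (simp add: of_nat_binomial_Suc sum_distrib_left sum_divide_distrib t_def mult_ac del: of_nat_Suc)
    then have "(q ^ m - 1) / of_nat m - (\<Sum>k<m. ?a k) =
        (\<Sum>k<m. (of_nat ((m - 1) choose k) - (- 1) ^ k) * (t * (t ^ k / of_nat (Suc k))))"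
      by (simp add: sum_subtractf[symmetric] diff_divide_distrib left_diff_distrib del: of_nat_Suc)
    also have "padic_abs \<dots> \<le> padic_abs (of_nat m :: 'a) * (padic_abs t * K)"
    proof (rule abs_sum_le)
      fix k
      have "padic_abs ((of_nat ((m - 1) choose k) - (- 1) ^ k) * (t * (t ^ k / of_nat (Suc k))))
          \<le> (padic_abs (of_nat m :: 'a) * real k) * (padic_abs t * c ^ k)"
        unfolding abs_mult c_def
        by (intro mult_mono abs_binomial_minus_sign_le m abs_power_div_le mult_nonneg_nonneg) auto
      also have "\<dots> = padic_abs (of_nat m :: 'a) * (padic_abs t * (real k * c ^ k))" by simp
      also have "\<dots> \<le> padic_abs (of_nat m :: 'a) * (padic_abs t * K)"
        using K by (intro mult_left_mono) auto
      finally show "padic_abs ((of_nat ((m - 1) choose k) - (- 1) ^ k) * (t * (t ^ k / of_nat (Suc k))))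
          \<le> padic_abs (of_nat m :: 'a) * (padic_abs t * K)" .
    qed (use K0 in auto)
    finally show ?thesis .
  qed
  have "(\<lambda>N. (q ^ (p ^ N) - 1) / of_nat (p ^ N) - (\<Sum>k<p ^ N. ?a k)) \<longlonglongrightarrow> 0"
  proof (rule tendsto_absI)
    show "padic_abs ((q ^ (p ^ N) - 1) / of_nat (p ^ N) - (\<Sum>k<p ^ N. ?a k) - 0)
        \<le> (1 / real p) ^ N * (padic_abs t * K)" for N
      using main[of "p ^ N"] p_gt_1 unfolding abs_p_power by simp
    show "(\<lambda>N. (1 / real p) ^ N * (padic_abs t * K)) \<longlonglongrightarrow> 0"
      by (intro tendsto_mult_left_zero p_power_null)
  qed
  moreover have "(\<lambda>N. \<Sum>k<p ^ N. ?a k) \<longlonglongrightarrow> padic_log q"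
  proof -
    have "(\<lambda>n. \<Sum>k<n. ?a k) \<longlonglongrightarrow> padic_log q"
      unfolding padic_log_def t_def by (rule summable_LIMSEQ[OF log_summable[OF q]])
    moreover have "strict_mono (\<lambda>N. p ^ N)"
      using p_gt_1 by (intro strict_monoI power_strict_increasing) auto
    ultimately show ?thesis by (rule LIMSEQ_subseq_LIMSEQ[unfolded o_def])
  qed
  ultimately have "(\<lambda>N. (q ^ (p ^ N) - 1) / of_nat (p ^ N) - (\<Sum>k<p ^ N. ?a k)
      + (\<Sum>k<p ^ N. ?a k)) \<longlonglongrightarrow> 0 + padic_log q"
    by (rule tendsto_add_padic)
  then show ?thesis by (simp only: diff_add_cancel add_0)
qed

text \<open>Instead of composing the two series, exp (m * log q) is compared with q^m for m = p^N.
  Both are 1 + m * log q up to o(|m|), and |r^m - 1| = |m| * |r - 1| turns this into a bound on the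
  fixed number r - 1.\<close>

lemma exp_log:
  assumes q: "padic_abs (q - 1 :: 'a) < rho"
  shows "padic_exp (padic_log q) = q"
proof -
  define L where "L = padic_log q"
  define r where "r = padic_exp L / q"
  have L: "padic_abs L < rho" using abs_log_le[OF q] q by (simp add: L_def)
  have q1: "padic_abs q = 1" using abs_eq_1[OF q] .
  then have q0: "q \<noteq> 0" by auto
  have "padic_abs (padic_exp L - 1) < rho" using abs_exp_minus_1_le[OF L] L by simp
  moreover have "r - 1 = ((padic_exp L - 1) - (q - 1)) / q"
    using q0 by (simp add: r_def field_simps)
  ultimately have r: "padic_abs (r - 1) < rho"
    using q ultrametric_diff[of "padic_exp L - 1" "q - 1"] by (simp add: abs_divide q1)
  have bound: "padic_abs (r - 1) \<le> max ((1 / real p) ^ N * (padic_abs L * (padic_abs L / rho)))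
      (padic_abs ((q ^ (p ^ N) - 1) / of_nat (p ^ N) - L))" (is "_ \<le> max ?u ?v") for N
  proof -
    define m where "m = p ^ N"
    have am: "padic_abs (of_nat m :: 'a) = (1 / real p) ^ N"
      unfolding m_def by (rule abs_p_power)
    have m0: "(of_nat m :: 'a) \<noteq> 0" using p_gt_1 by (simp add: m_def)
    have mL: "padic_abs (of_nat m * L) < rho" using abs_of_nat_mult_le[of m L] L by simp
    have "padic_abs (r - 1) * padic_abs (of_nat m :: 'a) = padic_abs (r ^ m - 1)"
      using abs_power_minus_1[OF r] by simp
    also have "r ^ m - 1 = (padic_exp (of_nat m * L) - q ^ m) / q ^ m"
      using q0 by (simp add: r_def power_divide exp_of_nat_mult[OF L] diff_divide_distrib)
    also have "padic_abs \<dots> = padic_abs (padic_exp (of_nat m * L) - q ^ m)"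
      by (simp add: abs_divide abs_power q1)
    \<comment> \<open>Inserting 1 + m * L separates the error of the linear approximation of exp
      from the error in the limit for log.\<close>
    also have "padic_exp (of_nat m * L) - q ^ m = (padic_exp (of_nat m * L) - 1 - of_nat m * L)
        - of_nat m * ((q ^ m - 1) / of_nat m - L)"
      using m0 by (simp add: field_simps)
    also have "padic_abs \<dots> \<le> max (padic_abs (of_nat m * L) * (padic_abs (of_nat m * L) / rho))
        (padic_abs (of_nat m :: 'a) * ?v)"
      using ultrametric_diff[of "padic_exp (of_nat m * L) - 1 - of_nat m * L"
          "of_nat m * ((q ^ m - 1) / of_nat m - L)"] abs_exp_minus_linear_le[OF mL]
      unfolding abs_mult[of _ "_ / _ - _"] m_def[symmetric] by linarith
    also have "\<dots> = max ?u ?v * padic_abs (of_nat m :: 'a)"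
      using max_mult_distrib_right[of ?u ?v "padic_abs (of_nat m :: 'a)"]
      by (simp add: abs_mult am mult_ac m_def[symmetric])
    finally show ?thesis using m0 by simp
  qed
  have "(\<lambda>N. max ((1 / real p) ^ N * (padic_abs L * (padic_abs L / rho)))
      (padic_abs ((q ^ (p ^ N) - 1) / of_nat (p ^ N) - L))) \<longlonglongrightarrow> max 0 0"
    using log_limit[OF q, folded L_def, unfolded tendsto_iff_abs]
    by (intro tendsto_max tendsto_mult_left_zero p_power_null)
  then have "padic_abs (r - 1) \<le> 0"
    using bound by (intro tendsto_lowerbound[of _ "max 0 0" sequentially, simplified]) auto
  then have "r = 1" using abs_nonneg[of "r - 1"] by (auto simp del: abs_nonneg)
  then show ?thesis using q0 by (simp add: r_def L_def)
qed

section \<open>Powers and brackets at natural numbers\<close>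

lemma padic_pow_of_nat:
  assumes "padic_abs (q - 1 :: 'a) < rho"
  shows "padic_pow q (of_nat m) = q ^ m"
proof -
  have "padic_abs (padic_log q) < rho" using abs_log_le[OF assms] assms by simp
  then show ?thesis by (simp add: padic_pow_def exp_of_nat_mult exp_log assms)
qed

text \<open>At q = 1 the convention in \<open>q_bracket\<close> agrees with the value m of the
  geometric sum, so no case distinction survives.\<close>

lemma q_bracket_of_nat:
  assumes "padic_abs (q - 1 :: 'a) < rho"
  shows "q_bracket q (of_nat m) = (\<Sum>i<m. q ^ i)"
  using assms by (simp add: q_bracket_def padic_pow_of_nat sum_gp_strict)

lemma q_bracket_pow_of_nat:
  assumes q: "padic_abs (q - 1 :: 'a) < rho" and "\<alpha> \<ge> 1"
  shows "q_bracket_pow q \<alpha> (of_nat m) = (\<Sum>i<m. (q ^ \<alpha>) ^ i)"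
  using padic_pow_of_nat[OF q, of "\<alpha> * m"]
  by (simp add: q_bracket_pow_def sum_gp_strict power_mult)

subsection \<open>The q-integral\<close>

lemma geometric_sum_add: "(\<Sum>i<a + b. (x :: 'a) ^ i) = (\<Sum>i<a. x ^ i) + x ^ a * (\<Sum>i<b. x ^ i)"
  by (induction b) (simp_all add: algebra_simps power_add)

text \<open>Each exponent below m * n is i + m * j with i < m and j < n in exactly one way.\<close>

lemma geometric_sum_mult:
  "(\<Sum>i<m * n. (x :: 'a) ^ i) = (\<Sum>i<m. x ^ i) * (\<Sum>j<n. (x ^ m) ^ j)"
proof (induction n)
  case (Suc n)
  have "m * Suc n = m * n + m" by simp
  then show ?case
    by (simp only: geometric_sum_add Suc power_mult sum.lessThan_Suc distrib_left mult.commute)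
qed simp

lemma geometric_sum_nonzero:
  assumes "padic_abs (q - 1 :: 'a) < rho" "m \<ge> 1"
  shows "(\<Sum>i<m. q ^ i) \<noteq> 0"
proof -
  have "padic_abs (\<Sum>i<m. q ^ i) \<noteq> 0"
    using assms by (simp add: abs_geometric_sum)
  then show ?thesis by (metis abs_zero)
qed

lemma geometric_sum_null:
  assumes "padic_abs (q - 1 :: 'a) < rho"
  shows "(\<lambda>N. \<Sum>i<p ^ N. q ^ i) \<longlonglongrightarrow> 0"
  unfolding tendsto_iff_abs diff_zero abs_geometric_sum[OF assms] abs_p_power
  by (rule p_power_null)

lemma power_p_power_limit:
  assumes "padic_abs (q - 1 :: 'a) < rho"
  shows "(\<lambda>N. q ^ (p ^ N)) \<longlonglongrightarrow> 1"
  unfolding tendsto_iff_abs abs_power_minus_1[OF assms] abs_p_power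
  by (intro tendsto_mult_right_zero p_power_null)

lemma abs_power_minus_1_less:
  assumes "padic_abs (q - 1 :: 'a) < rho"
  shows "padic_abs (q ^ m - 1) < rho"
proof -
  have "padic_abs (q ^ m - 1) \<le> padic_abs (q - 1)"
    using abs_of_nat_le_1[of m] by (simp add: abs_power_minus_1 assms mult_left_le)
  with assms show ?thesis by simp
qed

text \<open>Evaluating the bracket of \<alpha> * p^N in two ways expresses the ratio through the
  bracket of \<alpha> to base q^(p^N). That base tends to 1, so this bracket tends to
  \<alpha>.\<close>

lemma geometric_sum_ratio_limit:
  assumes q: "padic_abs (q - 1 :: 'a) < rho" and \<alpha>: "\<alpha> \<ge> 1"
  shows "(\<lambda>N. (\<Sum>i<p ^ N. (q ^ \<alpha>) ^ i) / (\<Sum>i<p ^ N. q ^ i)) \<longlonglongrightarrow> of_nat \<alpha> / (\<Sum>i<\<alpha>. q ^ i)"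
proof -
  have "(\<Sum>i<p ^ N. (q ^ \<alpha>) ^ i) / (\<Sum>i<p ^ N. q ^ i) =
      inverse (\<Sum>i<\<alpha>. q ^ i) * (\<Sum>i<\<alpha>. (q ^ (p ^ N)) ^ i)" for N
  proof -
    have "p ^ N \<ge> 1" using p_gt_1 by simp
    moreover have "(\<Sum>i<\<alpha>. q ^ i) * (\<Sum>i<p ^ N. (q ^ \<alpha>) ^ i) =
        (\<Sum>i<p ^ N. q ^ i) * (\<Sum>i<\<alpha>. (q ^ (p ^ N)) ^ i)"
      using geometric_sum_mult[of q \<alpha> "p ^ N"] geometric_sum_mult[of q "p ^ N" \<alpha>]
      by (simp add: mult.commute)
    ultimately show ?thesis
      using geometric_sum_nonzero[OF q \<alpha>] geometric_sum_nonzero[OF q, of "p ^ N"]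
      by (simp add: field_simps)
  qed
  moreover have "(\<lambda>N. inverse (\<Sum>i<\<alpha>. q ^ i) * (\<Sum>i<\<alpha>. (q ^ (p ^ N)) ^ i)) \<longlonglongrightarrow>
      inverse (\<Sum>i<\<alpha>. q ^ i) * (\<Sum>i<\<alpha>. 1 ^ i)"
    by (intro tendsto_mult_left_padic tendsto_sum_padic tendsto_power_padic power_p_power_limit q)
  ultimately show ?thesis by (simp add: divide_inverse mult.commute)
qed

section \<open>Moments of the bracket to base q^\<alpha>\<close>

context
  fixes q :: 'a and \<alpha> :: nat
  assumes q_close: "padic_abs (q - 1) < rho" and \<alpha>_ge_1: "\<alpha> \<ge> 1"
begin

abbreviation bq :: "nat \<Rightarrow> 'a" where "bq m \<equiv> \<Sum>i<m. q ^ i"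
abbreviation ba :: "nat \<Rightarrow> 'a" where "ba m \<equiv> \<Sum>i<m. (q ^ \<alpha>) ^ i"

lemma ba_Suc: "ba (Suc m) = 1 + q ^ \<alpha> * ba m"
  using geometric_sum_add[of "q ^ \<alpha>" 1 m] by simp

lemma bq_p_power_nonzero: "bq (p ^ N) \<noteq> 0"
  using p_gt_1 by (intro geometric_sum_nonzero q_close) simp

lemma ba_null: "(\<lambda>N. ba (p ^ N)) \<longlonglongrightarrow> 0"
  by (intro geometric_sum_null abs_power_minus_1_less q_close)

text \<open>One factor \<open>ba\<close> is paired with the denominator; the other k - 1 tend to 0.
  The power of 0 keeps the cases k = 1 and k > 1 together.\<close>

lemma boundary_term_limit:
  assumes "k \<ge> 1"
  shows "(\<lambda>N. ba (p ^ N) ^ k * q ^ (p ^ N) / bq (p ^ N)) \<longlonglongrightarrow> of_nat \<alpha> / bq \<alpha> * (0 ^ (k - 1) * 1)"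
proof -
  have "ba m ^ k = ba m * ba m ^ (k - 1)" for m
    using assms by (simp add: power_eq_if)
  moreover have "(\<lambda>N. ba (p ^ N) / bq (p ^ N) * (ba (p ^ N) ^ (k - 1) * q ^ (p ^ N)))
      \<longlonglongrightarrow> of_nat \<alpha> / bq \<alpha> * (0 ^ (k - 1) * 1)"
    by (intro tendsto_mult_padic tendsto_power_padic geometric_sum_ratio_limit ba_null
        power_p_power_limit q_close \<alpha>_ge_1)
  ultimately show ?thesis by (simp add: mult.assoc)
qed

text \<open>The left-hand side is the telescoped sum of the increments of
  \<open>ba y ^ k * q ^ y\<close>, which vanishes at y = 0 as k \<ge> 1. In the expansion of (1 +
  q^\<alpha> * \<open>ba y\<close>)^k the top term joins the subtracted one and the lower moments
  remain.\<close>

lemma boundary_term_recursion: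
  assumes "k \<ge> 1"
  shows "ba m ^ k * q ^ m = (q * (q ^ \<alpha>) ^ k - 1) * (\<Sum>y<m. ba y ^ k * q ^ y)
    + q * (\<Sum>j<k. of_nat (k choose j) * (q ^ \<alpha>) ^ j * (\<Sum>y<m. ba y ^ j * q ^ y))"
proof (induction m)
  case 0
  show ?case using assms by simp
next
  case (Suc m)
  have "ba (Suc m) ^ k = (\<Sum>j\<le>k. of_nat (k choose j) * (q ^ \<alpha> * ba m) ^ j)"
    using binomial_ring[of "q ^ \<alpha> * ba m" 1 k] by (simp only: ba_Suc add.commute power_one mult_1_right)
  also have "\<dots> = (q ^ \<alpha>) ^ k * ba m ^ k + (\<Sum>j<k. of_nat (k choose j) * (q ^ \<alpha>) ^ j * ba m ^ j)"
    by (simp add: lessThan_Suc_atMost[symmetric] power_mult_distrib mult.assoc)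
  finally have 1: "ba (Suc m) ^ k * q ^ Suc m = ba m ^ k * q ^ m
      + ((q * (q ^ \<alpha>) ^ k - 1) * (ba m ^ k * q ^ m)
      + q * (\<Sum>j<k. of_nat (k choose j) * (q ^ \<alpha>) ^ j * (ba m ^ j * q ^ m)))"
    by (simp add: algebra_simps sum_distrib_left del: sum.lessThan_Suc)
  have 2: "(q * (q ^ \<alpha>) ^ k - 1) * (\<Sum>y<Suc m. ba y ^ k * q ^ y)
      + q * (\<Sum>j<k. of_nat (k choose j) * (q ^ \<alpha>) ^ j * (\<Sum>y<Suc m. ba y ^ j * q ^ y)) =
      (q * (q ^ \<alpha>) ^ k - 1) * (\<Sum>y<m. ba y ^ k * q ^ y)
      + q * (\<Sum>j<k. of_nat (k choose j) * (q ^ \<alpha>) ^ j * (\<Sum>y<m. ba y ^ j * q ^ y))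
      + ((q * (q ^ \<alpha>) ^ k - 1) * (ba m ^ k * q ^ m)
      + q * (\<Sum>j<k. of_nat (k choose j) * (q ^ \<alpha>) ^ j * (ba m ^ j * q ^ m)))"
    by (simp add: distrib_left sum.distrib)
  show ?case unfolding 1 2 add_right_cancel by (rule Suc)
qed

text \<open>By strong induction the recursion is solved for its highest moment. The coefficient q^(1
  + \<alpha> * k) - 1 vanishes at q = 1, so that case uses the recursion of the next index.\<close>

lemma moment_convergent:
  "\<exists>l. (\<lambda>N. (\<Sum>y<p ^ N. ba y ^ k * q ^ y) / bq (p ^ N)) \<longlonglongrightarrow> l"
proof (induction k rule: less_induct)
  case (less k)
  define S where "S j N = (\<Sum>y<p ^ N. ba y ^ j * q ^ y) / bq (p ^ N)" for j N
  define U where "U j N = ba (p ^ N) ^ j * q ^ (p ^ N) / bq (p ^ N)" for j N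
  have U: "U j N = (q * (q ^ \<alpha>) ^ j - 1) * S j N
      + q * (\<Sum>i<j. of_nat (j choose i) * (q ^ \<alpha>) ^ i * S i N)" if "j \<ge> 1" for j N
    unfolding U_def S_def
    by (subst boundary_term_recursion[OF that])
       (simp only: add_divide_distrib sum_divide_distrib[of _ "{..<j}"] times_divide_eq_right[symmetric])
  have "\<forall>i\<in>{..<k}. \<exists>l. S i \<longlonglongrightarrow> l"
    using less.IH by (simp add: S_def[abs_def])
  then obtain l where "\<forall>i\<in>{..<k}. S i \<longlonglongrightarrow> l i"
    using bchoice[of "{..<k}" "\<lambda>i l. S i \<longlonglongrightarrow> l"] by blast
  then have l: "S i \<longlonglongrightarrow> l i" if "i < k" for i using that by simp
  \<comment> \<open>The index j is kept apart from k: it will be k for q \<noteq> 1 and k + 1 for q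
    = 1, with only the moments below k on the right.\<close>
  have lim: "(\<lambda>N. c * (U j N - q * (\<Sum>i<k. of_nat (j choose i) * (q ^ \<alpha>) ^ i * S i N)))
      \<longlonglongrightarrow> c * (of_nat \<alpha> / bq \<alpha> * (0 ^ (j - 1) * 1)
        - q * (\<Sum>i<k. of_nat (j choose i) * (q ^ \<alpha>) ^ i * l i))" if "j \<ge> 1" for c j
    using boundary_term_limit[OF that] unfolding U_def
    by (intro tendsto_mult_left_padic tendsto_diff_padic tendsto_sum_padic l) auto
  have "\<exists>m. S k \<longlonglongrightarrow> m"
  proof (cases "q = 1")
    case True
    \<comment> \<open>The recursion of index k + 1 loses its highest moment here and determines
      \<open>S k\<close>, with coefficient (k + 1 choose k) = k + 1.\<close>
    have "U (Suc k) N - q * (\<Sum>i<k. of_nat (Suc k choose i) * (q ^ \<alpha>) ^ i * S i N) =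
        of_nat (Suc k) * S k N" for N
      using U[of "Suc k" N] by (simp add: True del: of_nat_Suc binomial_Suc_Suc)
    then have "S k = (\<lambda>N. inverse (of_nat (Suc k)) *
        (U (Suc k) N - q * (\<Sum>i<k. of_nat (Suc k choose i) * (q ^ \<alpha>) ^ i * S i N)))"
      by (simp add: fun_eq_iff mult.assoc[symmetric] del: of_nat_Suc binomial_Suc_Suc)
    with lim[of "Suc k" "inverse (of_nat (Suc k))"] show ?thesis by (metis le_add1 plus_1_eq_Suc)
  next
    case False
    show ?thesis
    proof (cases "k = 0")
      case True
      then have "S k = (\<lambda>N. 1)" using bq_p_power_nonzero by (simp add: S_def fun_eq_iff)
      then show ?thesis by auto
    next
      case k: False
      \<comment> \<open>The value is |q - 1| * |1 + \<alpha> * k|, and both factors are nonzero in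
        characteristic 0 with q \<noteq> 1.\<close>
      have "padic_abs (q ^ Suc (\<alpha> * k) - 1) \<noteq> 0"
        using False by (simp add: abs_power_minus_1 q_close del: of_nat_Suc power_Suc)
      then have "q * (q ^ \<alpha>) ^ k - 1 \<noteq> 0" by (metis abs_zero power_Suc power_mult)
      then have "S k = (\<lambda>N. inverse (q * (q ^ \<alpha>) ^ k - 1) *
          (U k N - q * (\<Sum>i<k. of_nat (k choose i) * (q ^ \<alpha>) ^ i * S i N)))"
        using k by (simp add: fun_eq_iff U)
      moreover have "k \<ge> 1" using k by simp
      ultimately show ?thesis using lim[of k "inverse (q * (q ^ \<alpha>) ^ k - 1)"] by metis
    qed
  qed
  then show ?case by (simp add: S_def[abs_def])
qed

text \<open>As \<open>g\<close> adds two neighbouring terms, the middle one cancels in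
  \<open>g (Suc y) - g y\<close> and the shift by 2 telescopes. The right-hand side displays factors
  \<open>ba m\<close> and \<open>bq m\<close>, ready for division by \<open>bq m\<close>.\<close>

lemma shift_by_2_identity:
  assumes "n \<ge> 1"
  shows "q ^ 2 * ((\<Sum>y<m. ba (y + 2) ^ n * q ^ y)) - (\<Sum>y<m. ba y ^ n * q ^ y) =
    q * (q ^ \<alpha> * ba m * (\<Sum>i<n. ba (Suc m) ^ i) * q ^ m + (q - 1) * bq m) + ba m ^ n * q ^ m"
proof -
  define g where "g y = ba (Suc y) ^ n * q ^ Suc y + ba y ^ n * q ^ y" for y
  have "q ^ 2 * ((\<Sum>y<m. ba (y + 2) ^ n * q ^ y)) - (\<Sum>y<m. ba y ^ n * q ^ y) =
      (\<Sum>y<m. g (Suc y) - g y)"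
    unfolding sum_distrib_left sum_subtractf[symmetric]
    by (intro sum.cong) (simp_all add: g_def power2_eq_square algebra_simps del: sum.lessThan_Suc)
  also have "\<dots> = g m - g 0" by (rule sum_lessThan_telescope)
  also have "g 0 = q" using assms by (simp add: g_def)
  \<comment> \<open>With B = \<open>ba (Suc m) ^ n\<close>, the difference B * q^m - 1 is split as
    (B - 1) * q^m + (q^m - 1), and both parts factor.\<close>
  also have "g m - q = q * ((ba (Suc m) ^ n - 1) * q ^ m + (q ^ m - 1)) + ba m ^ n * q ^ m"
    by (simp add: g_def algebra_simps del: sum.lessThan_Suc)
  also have "ba (Suc m) ^ n - 1 = q ^ \<alpha> * ba m * (\<Sum>i<n. ba (Suc m) ^ i)"
    unfolding ba_Suc[of m] power_diff_1_eq by simp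
  also have "q ^ m - 1 = (q - 1) * bq m" by (rule power_diff_1_eq)
  finally show ?thesis .
qed

text \<open>After division the term with \<open>bq\<close> becomes the constant q - 1, and
  \<open>R\<close> tends to \<alpha> / [\<alpha>]. The powers of 1 + q^\<alpha> *
  \<open>ba (p ^ N)\<close> tend to 1, and there are n of them, whence the factor n.\<close>

lemma shift_by_2_limit:
  assumes n: "n > 1"
    and l: "(\<lambda>N. (\<Sum>y<p ^ N. ba y ^ n * q ^ y) / bq (p ^ N)) \<longlonglongrightarrow> l"
  shows "(\<lambda>N. (\<Sum>y<p ^ N. ba (y + 2) ^ n * q ^ y) / bq (p ^ N)) \<longlonglongrightarrow>
    (q * (of_nat n * q ^ \<alpha> * (of_nat \<alpha> / bq \<alpha>) + (q - 1)) + l) / q ^ 2"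
proof -
  define R where "R N = ba (p ^ N) / bq (p ^ N)" for N
  define S where "S N = (\<Sum>y<p ^ N. ba y ^ n * q ^ y) / bq (p ^ N)" for N
  have q0: "q \<noteq> 0" using abs_eq_1[OF q_close] by auto
  have eq: "(\<Sum>y<p ^ N. ba (y + 2) ^ n * q ^ y) / bq (p ^ N) = inverse (q ^ 2) *
      (q * (q ^ \<alpha> * R N * (\<Sum>i<n. (1 + q ^ \<alpha> * ba (p ^ N)) ^ i) * q ^ (p ^ N) + (q - 1))
        + ba (p ^ N) ^ n * q ^ (p ^ N) / bq (p ^ N) + S N)" (is "?A / ?b = _") for N
  proof -
    have "?A = inverse (q ^ 2) * (q * (q ^ \<alpha> * ba (p ^ N) * (\<Sum>i<n. ba (Suc (p ^ N)) ^ i)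
        * q ^ (p ^ N) + (q - 1) * ?b) + ba (p ^ N) ^ n * q ^ (p ^ N) + (\<Sum>y<p ^ N. ba y ^ n * q ^ y))"
      using shift_by_2_identity[of n "p ^ N"] n q0 by (simp add: field_simps del: sum.lessThan_Suc)
    then show ?thesis
      unfolding ba_Suc using bq_p_power_nonzero[of N]
      by (simp add: R_def S_def add_divide_distrib distrib_left)
  qed
  have "(\<lambda>N. inverse (q ^ 2) *
      (q * (q ^ \<alpha> * R N * (\<Sum>i<n. (1 + q ^ \<alpha> * ba (p ^ N)) ^ i) * q ^ (p ^ N) + (q - 1))
        + ba (p ^ N) ^ n * q ^ (p ^ N) / bq (p ^ N) + S N)) \<longlonglongrightarrow>
      inverse (q ^ 2) *
      (q * (q ^ \<alpha> * (of_nat \<alpha> / bq \<alpha>) * (\<Sum>i<n. (1 + q ^ \<alpha> * 0) ^ i) * 1 + (q - 1))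
        + of_nat \<alpha> / bq \<alpha> * (0 ^ (n - 1) * 1) + l)"
    unfolding R_def S_def using n
    by (intro tendsto_mult_left_padic tendsto_add_padic tendsto_mult_padic tendsto_sum_padic
        tendsto_power_padic tendsto_const ba_null power_p_power_limit q_close
        geometric_sum_ratio_limit \<alpha>_ge_1 boundary_term_limit l) auto
  \<comment> \<open>Since n > 1, \<open>0 ^ (n - 1)\<close> is 0 and the boundary term
    disappears.\<close>
  then show ?thesis unfolding eq using n by (simp add: divide_inverse zero_power mult_ac)
qed

lemma q_bernoulli_poly_of_nat:
  "q_bernoulli_poly p \<alpha> n q (of_nat x) = lim (\<lambda>N. (\<Sum>y<p ^ N. ba (y + x) ^ n * q ^ y) / bq (p ^ N))"
proof -
  have "q_bracket_pow q \<alpha> (of_nat x + of_nat y) = ba (y + x)" for y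
    using q_bracket_pow_of_nat[OF q_close \<alpha>_ge_1, of "y + x"] by (simp add: add.commute)
  then show ?thesis
    unfolding q_bernoulli_poly_def padic_q_integral_def q_bracket_of_nat[OF q_close] by simp
qed

lemma q_bernoulli_shift:
  assumes "n > 1"
  shows "q ^ 2 * q_bernoulli_poly p \<alpha> n q 2 =
    of_nat n * q ^ (1 + \<alpha>) * (of_nat \<alpha> / q_bracket q (of_nat \<alpha>))
      + q ^ 2 - q + q_bernoulli p \<alpha> n q"
proof -
  \<comment> \<open>The integral is a \<open>lim\<close>, so its value can be read off only once the
    moments are known to converge.\<close>
  obtain l where l: "(\<lambda>N. (\<Sum>y<p ^ N. ba y ^ n * q ^ y) / bq (p ^ N)) \<longlonglongrightarrow> l"
    using moment_convergent by blast
  have "q_bernoulli p \<alpha> n q = l"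
    using limI[OF l] q_bernoulli_poly_of_nat[of n 0] by (simp add: q_bernoulli_def)
  moreover have "q_bernoulli_poly p \<alpha> n q 2 =
      (q * (of_nat n * q ^ \<alpha> * (of_nat \<alpha> / bq \<alpha>) + (q - 1)) + l) / q ^ 2"
    using limI[OF shift_by_2_limit[OF assms l]] q_bernoulli_poly_of_nat[of n 2] by simp
  moreover have "q \<noteq> 0" using abs_eq_1[OF q_close] by auto
  ultimately have "q ^ 2 * q_bernoulli_poly p \<alpha> n q 2 =
      q * (of_nat n * q ^ \<alpha> * (of_nat \<alpha> / bq \<alpha>) + (q - 1)) + q_bernoulli p \<alpha> n q"
    by simp
  then show ?thesis
    by (simp add: q_bracket_of_nat[OF q_close] power2_eq_square algebra_simps)
qed

end

end

theorem theorem11: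
  fixes p n \<alpha> :: nat and q :: "'a::{field_char_0, complete_space}"
  assumes "is_padic_complex p TYPE('a)"
    and "prime p" and "odd p"
    and "padic_abs (1 - q) < real p powr (- 1 / (real p - 1))"
    and "\<alpha> \<ge> 1" and "n > 1"
  shows "q ^ 2 * q_bernoulli_poly p \<alpha> n q 2 =
    of_nat n * q ^ (1 + \<alpha>) * (of_nat \<alpha> / q_bracket q (of_nat \<alpha>))
      + q ^ 2 - q + q_bernoulli p \<alpha> n q"
proof -
  interpret padic_field p "TYPE('a)"
    using assms(1) by unfold_locales (auto simp: is_padic_complex_def)
  have "padic_abs (q - 1) < rho"
    using assms(4) abs_minus_commute[of 1 q] by (simp add: rho_def)
  then show ?thesis using assms(5,6) by (rule q_bernoulli_shift)
qed

end
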